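(* Let $d\ge 1$ and let $\mathbf{v}_1+\mathcal{L}_1,\dots,\mathbf{v}_n+\mathcal{L}_n$ be a lattice tiling of $\mathbb{Z}^d$. Let $p$ be a prime and $k\ge 1$ an integer. If $p^k$ divides $\det\mathcal{L}_i$ for some $i\in\{1,\dots,n\}$, then there exists $j\in\{1,\dots,n\}$ with $j\neq i$ such that $p^k$ divides $\det\mathcal{L}_j$.
   Context: A sublattice is a full-rank (equivalently finite-index) subgroup of $\mathbb{Z}^d$. Its determinant $\det\mathcal{L}$ is its index in $\mathbb{Z}^d$. For $\mathbf{v}\in\mathbb{Z}^d$, $\mathbf{v}+\mathcal{L}=\{\mathbf{v}+\mathbf{w} : \mathbf{w}\in\mathcal{L}\}$. A lattice tiling of $\mathbb{Z}^d$ is a finite collection of sublattices $\mathcal{L}_1,\dots,\mathcal{L}_n$ and vectors $\mathbf{v}_1,\dots,\mathbf{v}_n\in\mathbb{Z}^d$ such that the sets $\mathbf{v}_i+\mathcal{L}_i$ are pairwise disjoint (for distinct indices) and their union is $\mathbb{Z}^d$. *)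

theory Defs
  imports
    "HOL-Analysis.Finite_Cartesian_Product"
    "HOL-Library.Disjoint_Sets"
    "HOL-Algebra.Coset"
    "HOL-Computational_Algebra.Primes"
begin

text \<open>The additive group \<open>\<int>\<^sup>d\<close>, with \<open>d = CARD('d)\<close>. Type \<open>'d\<close> is nonempty, so \<open>d \<ge> 1\<close>.\<close>

definition int_vec_group :: "(int ^ 'd) monoid" where
  "int_vec_group = \<lparr>carrier = UNIV, monoid.mult = (+), one = 0\<rparr>"

definition sublattice :: "(int ^ 'd) set \<Rightarrow> bool" where
  "sublattice L \<longleftrightarrow> subgroup L int_vec_group \<and> finite (rcosets\<^bsub>int_vec_group\<^esub> L)"

text \<open>The determinant of a sublattice is its index; finiteness of the index is part of
  \<open>sublattice\<close>, so the value 0 that \<open>card\<close> gives to infinite sets does not arise there.\<close>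

definition lattice_det :: "(int ^ 'd) set \<Rightarrow> nat" where
  "lattice_det L = card (rcosets\<^bsub>int_vec_group\<^esub> L)"

definition lattice_tiling :: "nat \<Rightarrow> (nat \<Rightarrow> int ^ 'd) \<Rightarrow> (nat \<Rightarrow> (int ^ 'd) set) \<Rightarrow> bool" where
  "lattice_tiling n v L \<longleftrightarrow>
     (\<forall>i\<in>{1..n}. sublattice (L i)) \<and>
     disjoint_family_on (\<lambda>i. {v i + w |w. w \<in> L i}) {1..n} \<and>
     (\<Union>i\<in>{1..n}. {v i + w |w. w \<in> L i}) = UNIV"

end

theory Submission
  imports Defs
begin

text \<open>Only the densities of the tiles matter. A coset of a subgroup \<open>H\<close> occupies the fraction
  \<open>1/[G:H]\<close> of a group \<open>G\<close>, so a partition of \<open>G\<close> into cosets of \<open>H\<^sub>1, \<dots>, H\<^sub>n\<close> gives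
  \<open>\<Sum>\<^sub>j 1/[G:H\<^sub>j] = 1\<close>. If \<open>p\<^sup>k\<close>, with \<open>k \<ge> 1\<close>, divided exactly one of the indices, the
  corresponding summand would have \<open>p\<close>-adic valuation at most \<open>-k\<close>, whereas all the other
  summands, and the right-hand side \<open>1\<close>, would have valuation strictly larger than \<open>-k\<close>; this is
  impossible.

  To obtain the density identity without limits, all tiles are measured in units of one common
  subgroup of finite index, \<open>M = \<Inter>\<^sub>j H\<^sub>j\<close>: every coset of \<open>H\<^sub>j\<close> consists of the same number
  \<open>c\<^sub>j\<close> of cosets of \<open>M\<close>, and \<open>[G:H\<^sub>j] c\<^sub>j = [G:M] = \<Sum>\<^sub>j c\<^sub>j\<close>. This is carried out with
  right cosets in an arbitrary group and then specialised to \<open>\<int>\<^sup>d\<close>.\<close>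

text \<open>Here \<open>c j / N\<close> stands for \<open>1 / d j\<close>, so this is the valuation argument for
  \<open>\<Sum>\<^sub>j 1 / d j = 1\<close>, cleared of denominators: if \<open>d i\<close> were the only \<open>d j\<close> divisible by
  \<open>p\<^sup>k\<close>, then \<open>N\<close> and every other \<open>c j\<close> would be divisible by a power of \<open>p\<close> too high to
  divide \<open>c i\<close>.\<close>

lemma prime_power_dvd_second_denominator:
  fixes c d :: "'i \<Rightarrow> nat" and N p k :: nat
  assumes "finite I" and "i \<in> I" and "prime p" and "k \<ge> 1" and "N > 0"
    and prod: "\<And>j. j \<in> I \<Longrightarrow> d j * c j = N"
    and sum: "(\<Sum>j\<in>I. c j) = N"
    and dvd_i: "p ^ k dvd d i"
  shows "\<exists>j\<in>I. j \<noteq> i \<and> p ^ k dvd d j"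
proof (rule ccontr)
  assume "\<not> ?thesis"
  then have other: "\<not> p ^ k dvd d j" if "j \<in> I" "j \<noteq> i" for j
    using that by blast
  define a where "a = multiplicity p N"
  have p_elem: "prime_elem p" and not_unit: "\<not> is_unit p"
    using \<open>prime p\<close> by auto
  have dvd_N_iff: "p ^ r dvd N \<longleftrightarrow> r \<le> a" for r
    unfolding a_def using \<open>N > 0\<close> not_unit by (simp add: power_dvd_iff_le_multiplicity)
  have "p ^ k dvd N"
    using dvd_i prod[OF \<open>i \<in> I\<close>] by (metis dvd_mult2)
  then have "k \<le> a"
    using dvd_N_iff by simp
  \<comment> \<open>The exponent \<open>a + 1 - k\<close> is the least one that, added to \<open>k\<close>, exceeds the valuation of
    \<open>N\<close>.\<close>
  have dvd_c: "p ^ (a + 1 - k) dvd c j" if "j \<in> I" "j \<noteq> i" for j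
  proof -
    have nz: "d j \<noteq> 0" "c j \<noteq> 0"
      using prod[OF that(1)] \<open>N > 0\<close> by (auto intro: ccontr)
    have "a = multiplicity p (d j) + multiplicity p (c j)"
      unfolding a_def prod[OF that(1), symmetric]
      using nz p_elem by (simp add: prime_elem_multiplicity_mult_distrib)
    moreover have "multiplicity p (d j) < k"
      using other[OF that] nz not_unit by (simp add: power_dvd_iff_le_multiplicity)
    ultimately show ?thesis
      using nz not_unit by (simp add: power_dvd_iff_le_multiplicity)
  qed
  have "N = c i + (\<Sum>j\<in>I - {i}. c j)"
    using sum \<open>finite I\<close> \<open>i \<in> I\<close> by (simp add: sum.remove)
  moreover have "p ^ (a + 1 - k) dvd (\<Sum>j\<in>I - {i}. c j)"
    using dvd_c by (intro dvd_sum) auto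
  moreover have "p ^ (a + 1 - k) dvd N"
    using \<open>k \<ge> 1\<close> by (simp add: dvd_N_iff)
  ultimately have "p ^ (a + 1 - k) dvd c i"
    by (metis dvd_add_left_iff)
  then have "p ^ k * p ^ (a + 1 - k) dvd N"
    using mult_dvd_mono[OF dvd_i] prod[OF \<open>i \<in> I\<close>] by metis
  then have "p ^ (a + 1) dvd N"
    using \<open>k \<le> a\<close> by (simp flip: power_add)
  then show False
    using dvd_N_iff[of "a + 1"] by linarith
qed

context group
begin

lemma r_coset_mem_iff:
  assumes "subgroup H G" "x \<in> carrier G"
  shows "y \<in> H #> x \<longleftrightarrow> y \<in> carrier G \<and> y \<otimes> inv x \<in> H"
proof
  assume "y \<in> H #> x"
  then obtain h where "h \<in> H" "y = h \<otimes> x"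
    by (auto simp: r_coset_def)
  then show "y \<in> carrier G \<and> y \<otimes> inv x \<in> H"
    using assms subgroup.mem_carrier[OF assms(1)] by (simp add: m_assoc)
next
  assume y: "y \<in> carrier G \<and> y \<otimes> inv x \<in> H"
  then have "y = (y \<otimes> inv x) \<otimes> x"
    using assms by (simp add: m_assoc)
  with y show "y \<in> H #> x"
    by (auto simp: r_coset_def)
qed

lemma r_coset_Inter:
  assumes "I \<noteq> {}" "\<And>j. j \<in> I \<Longrightarrow> subgroup (H j) G" "x \<in> carrier G"
  shows "(\<Inter>j\<in>I. H j) #> x = (\<Inter>j\<in>I. H j #> x)"
proof -
  have "subgroup (\<Inter>j\<in>I. H j) G"
    using assms by (intro subgroups_Inter) auto
  with assms show ?thesis
    by (auto simp: r_coset_mem_iff)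
qed

text \<open>A coset of the intersection is determined by the tuple of cosets containing it, and there are
  only finitely many such tuples.\<close>

lemma finite_rcosets_Inter:
  assumes "finite I" "I \<noteq> {}" and H: "\<And>j. j \<in> I \<Longrightarrow> subgroup (H j) G"
    and fin: "\<And>j. j \<in> I \<Longrightarrow> finite (rcosets (H j))"
  shows "finite (rcosets (\<Inter>j\<in>I. H j))"
proof (rule finite_subset)
  show "rcosets (\<Inter>j\<in>I. H j) \<subseteq> (\<lambda>F. \<Inter>j\<in>I. F j) ` (\<Pi>\<^sub>E j\<in>I. rcosets (H j))"
  proof
    fix C assume "C \<in> rcosets (\<Inter>j\<in>I. H j)"
    then obtain x where x: "x \<in> carrier G" and "C = (\<Inter>j\<in>I. H j) #> x"
      by (auto simp: RCOSETS_def)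
    then have "C = (\<Inter>j\<in>I. (\<lambda>j\<in>I. H j #> x) j)"
      using r_coset_Inter[OF \<open>I \<noteq> {}\<close> H] by simp
    moreover have "(\<lambda>j\<in>I. H j #> x) \<in> (\<Pi>\<^sub>E j\<in>I. rcosets (H j))"
      using x by (auto simp: RCOSETS_def)
    ultimately show "C \<in> (\<lambda>F. \<Inter>j\<in>I. F j) ` (\<Pi>\<^sub>E j\<in>I. rcosets (H j))"
      by blast
  qed
  show "finite ((\<lambda>F. \<Inter>j\<in>I. F j) ` (\<Pi>\<^sub>E j\<in>I. rcosets (H j)))"
    using assms by (intro finite_imageI finite_PiE) auto
qed

lemma r_coset_subset_r_coset:
  assumes M: "subgroup M G" and H: "subgroup H G" and "M \<subseteq> H"
    and x: "x \<in> carrier G" and g: "g \<in> carrier G" and "x \<in> H #> g"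
  shows "M #> x \<subseteq> H #> g"
proof -
  have "M #> x \<subseteq> H #> x"
    using \<open>M \<subseteq> H\<close> by (auto simp: r_coset_def)
  also have "H #> x = H #> g"
    using repr_independence[OF \<open>x \<in> H #> g\<close> g H] by simp
  finally show ?thesis .
qed

lemma r_coset_self_mem:
  assumes "subgroup H G" "x \<in> carrier G"
  shows "x \<in> H #> x"
  using assms rcos_self by blast

text \<open>Since \<open>M\<close> is contained in every \<open>H j\<close>, a coset of \<open>M\<close> that meets a tile lies inside it, so
  the tiles never cut through a coset of \<open>M\<close>.\<close>

lemma rcosets_eq_Union_subsets:
  assumes M: "subgroup M G" and H: "\<And>j. j \<in> I \<Longrightarrow> subgroup (H j) G"
    and MH: "\<And>j. j \<in> I \<Longrightarrow> M \<subseteq> H j" and v: "\<And>j. j \<in> I \<Longrightarrow> v j \<in> carrier G"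
    and cover: "(\<Union>j\<in>I. H j #> v j) = carrier G"
  shows "rcosets M = (\<Union>j\<in>I. {C \<in> rcosets M. C \<subseteq> H j #> v j})"
proof -
  have "\<exists>j\<in>I. C \<subseteq> H j #> v j" if C: "C \<in> rcosets M" for C
  proof -
    obtain x where x: "x \<in> carrier G" "C = M #> x"
      using C by (auto simp: RCOSETS_def)
    then obtain j where j: "j \<in> I" "x \<in> H j #> v j"
      using cover by auto
    then show ?thesis
      using r_coset_subset_r_coset[OF M H MH x(1) v] x(2) by blast
  qed
  then show ?thesis by blast
qed

lemma card_rcosets_eq_sum:
  assumes M: "subgroup M G" and fin: "finite (rcosets M)" and "finite I"
    and H: "\<And>j. j \<in> I \<Longrightarrow> subgroup (H j) G"
    and MH: "\<And>j. j \<in> I \<Longrightarrow> M \<subseteq> H j" and v: "\<And>j. j \<in> I \<Longrightarrow> v j \<in> carrier G"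
    and disj: "disjoint_family_on (\<lambda>j. H j #> v j) I"
    and cover: "(\<Union>j\<in>I. H j #> v j) = carrier G"
  shows "card (rcosets M) = (\<Sum>j\<in>I. card {C \<in> rcosets M. C \<subseteq> H j #> v j})"
proof -
  have nonempty: "C \<noteq> {}" if "C \<in> rcosets M" for C
    using that r_coset_self_mem[OF M] by (auto simp: RCOSETS_def)
  have "card (\<Union>j\<in>I. {C \<in> rcosets M. C \<subseteq> H j #> v j})
      = (\<Sum>j\<in>I. card {C \<in> rcosets M. C \<subseteq> H j #> v j})"
  proof (rule card_UN_disjoint[OF \<open>finite I\<close>])
    show "\<forall>j\<in>I. finite {C \<in> rcosets M. C \<subseteq> H j #> v j}"
      using fin by simp
    show "\<forall>j\<in>I. \<forall>l\<in>I. j \<noteq> l \<longrightarrow>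
        {C \<in> rcosets M. C \<subseteq> H j #> v j} \<inter> {C \<in> rcosets M. C \<subseteq> H l #> v l} = {}"
      using disj nonempty unfolding disjoint_family_on_def by blast
  qed
  then show ?thesis
    using rcosets_eq_Union_subsets[OF M H MH v cover] by simp
qed

text \<open>All cosets of \<open>H\<close> are equally large in units of \<open>M\<close>, because right translation by \<open>g\<close>
  carries \<open>H\<close> to \<open>H #> g\<close> and permutes the cosets of \<open>M\<close>.\<close>

lemma card_rcosets_within_r_coset:
  assumes M: "subgroup M G" and H: "subgroup H G" and g: "g \<in> carrier G"
  shows "card {C \<in> rcosets M. C \<subseteq> H #> g} = card {C \<in> rcosets M. C \<subseteq> H}"
proof (rule sym, rule bij_betw_same_card, rule bij_betwI)
  have sub: "C \<subseteq> carrier G" if "C \<in> rcosets M" for C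
    using that rcosets_subset_PowG[OF M] by blast
  have shift: "C #> a \<in> rcosets M" if C: "C \<in> rcosets M" and a: "a \<in> carrier G" for C a
  proof -
    obtain x where x: "x \<in> carrier G" "C = M #> x"
      using C by (auto simp: RCOSETS_def)
    then have "C #> a = M #> (x \<otimes> a)"
      using a coset_mult_assoc[OF subgroup.subset[OF M]] by simp
    then show ?thesis
      using a x(1) by (auto simp: RCOSETS_def)
  qed
  have mono: "A #> a \<subseteq> B #> a" if "A \<subseteq> B" for A B a
    using that by (auto simp: r_coset_def)
  have unshift: "(A #> a) #> b = A"
    if "A \<subseteq> carrier G" "a \<in> carrier G" "b \<in> carrier G" "a \<otimes> b = \<one>" for A a b
    using that by (simp add: coset_mult_assoc coset_mult_one)
  have H_sub: "H \<subseteq> carrier G"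
    using H by (rule subgroup.subset)
  show "(\<lambda>C. C #> g) \<in> {C \<in> rcosets M. C \<subseteq> H} \<rightarrow> {C \<in> rcosets M. C \<subseteq> H #> g}"
    using shift[OF _ g] mono by blast
  show "(\<lambda>C. C #> inv g) \<in> {C \<in> rcosets M. C \<subseteq> H #> g} \<rightarrow> {C \<in> rcosets M. C \<subseteq> H}"
    using shift[OF _ inv_closed[OF g]] mono[of _ "H #> g" "inv g"]
      unshift[OF H_sub g inv_closed[OF g] r_inv[OF g]] by blast
  show "(C #> g) #> inv g = C" if "C \<in> {C \<in> rcosets M. C \<subseteq> H}" for C
    using that g sub by (intro unshift) auto
  show "(C #> inv g) #> g = C" if "C \<in> {C \<in> rcosets M. C \<subseteq> H #> g}" for C
    using that g sub by (intro unshift) auto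
qed

text \<open>Multiplicativity of the index, \<open>[G:M] = [G:H] [H:M]\<close>, with \<open>[H:M]\<close> expressed as the number
  of cosets of \<open>M\<close> inside \<open>H\<close>: the cosets of \<open>H\<close> are themselves a tiling by sets of equal
  size.\<close>

lemma card_rcosets_mult:
  assumes M: "subgroup M G" and H: "subgroup H G" and "M \<subseteq> H"
    and fin: "finite (rcosets M)" and fin_H: "finite (rcosets H)"
  shows "card (rcosets H) * card {C \<in> rcosets M. C \<subseteq> H} = card (rcosets M)"
proof -
  define rep where "rep C = (SOME x. x \<in> carrier G \<and> C = H #> x)" for C
  have rep: "rep C \<in> carrier G" "H #> rep C = C" if "C \<in> rcosets H" for C
  proof -
    have "\<exists>x. x \<in> carrier G \<and> C = H #> x"
      using that by (auto simp: RCOSETS_def)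
    then have "rep C \<in> carrier G \<and> C = H #> rep C"
      unfolding rep_def by (rule someI_ex)
    then show "rep C \<in> carrier G" "H #> rep C = C" by auto
  qed
  have "card (rcosets M) = (\<Sum>D\<in>rcosets H. card {C \<in> rcosets M. C \<subseteq> H #> rep D})"
  proof (rule card_rcosets_eq_sum[OF M fin fin_H, where H = "\<lambda>_. H"])
    show "disjoint_family_on (\<lambda>D. H #> rep D) (rcosets H)"
      using rep rcos_disjoint[OF H] by (auto simp: disjoint_family_on_def disjnt_def pairwise_def)
    show "(\<Union>D\<in>rcosets H. H #> rep D) = carrier G"
      using rep rcosets_part_G[OF H] by auto
  qed (use H \<open>M \<subseteq> H\<close> rep in auto)
  also have "\<dots> = (\<Sum>D\<in>rcosets H. card {C \<in> rcosets M. C \<subseteq> H})"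
    using card_rcosets_within_r_coset[OF M H rep(1)] by (intro sum.cong refl)
  finally show ?thesis by simp
qed

theorem coset_partition_prime_power_dvd_second_index:
  assumes "finite I" and "i \<in> I" and H: "\<And>j. j \<in> I \<Longrightarrow> subgroup (H j) G"
    and fin: "\<And>j. j \<in> I \<Longrightarrow> finite (rcosets (H j))"
    and v: "\<And>j. j \<in> I \<Longrightarrow> v j \<in> carrier G"
    and disj: "disjoint_family_on (\<lambda>j. H j #> v j) I"
    and cover: "(\<Union>j\<in>I. H j #> v j) = carrier G"
    and "prime p" and "k \<ge> 1" and "p ^ k dvd card (rcosets (H i))"
  shows "\<exists>j\<in>I. j \<noteq> i \<and> p ^ k dvd card (rcosets (H j))"
proof -
  define M where "M = (\<Inter>j\<in>I. H j)"
  define c where "c j = card {C \<in> rcosets M. C \<subseteq> H j}" for j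
  have M: "subgroup M G"
    unfolding M_def using H \<open>i \<in> I\<close> by (intro subgroups_Inter) auto
  have MH: "M \<subseteq> H j" if "j \<in> I" for j
    using that by (auto simp: M_def)
  have fin_M: "finite (rcosets M)"
    unfolding M_def using \<open>finite I\<close> \<open>i \<in> I\<close> H fin by (intro finite_rcosets_Inter) auto
  show ?thesis
  proof (rule prime_power_dvd_second_denominator[where c = c and N = "card (rcosets M)"])
    have "M #> \<one> \<in> rcosets M"
      by (auto simp: RCOSETS_def)
    then show "card (rcosets M) > 0"
      using fin_M by (auto simp: card_gt_0_iff)
    show "card (rcosets (H j)) * c j = card (rcosets M)" if "j \<in> I" for j
      unfolding c_def using card_rcosets_mult[OF M H MH fin_M fin] that by blast
    show "(\<Sum>j\<in>I. c j) = card (rcosets M)"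
      using card_rcosets_eq_sum[OF M fin_M \<open>finite I\<close> H MH v disj cover]
        card_rcosets_within_r_coset[OF M H v] by (simp add: c_def)
  qed (use assms in auto)
qed

end

lemma group_int_vec_group: "group (int_vec_group :: (int ^ 'd::finite) monoid)"
proof (rule groupI)
  fix x :: "int ^ 'd"
  show "\<exists>y\<in>carrier int_vec_group. y \<otimes>\<^bsub>int_vec_group\<^esub> x = \<one>\<^bsub>int_vec_group\<^esub>"
    by (rule bexI[of _ "- x"]) (auto simp: int_vec_group_def)
qed (auto simp: int_vec_group_def add.assoc)

lemma r_coset_int_vec_group: "L #>\<^bsub>int_vec_group\<^esub> v = {v + w |w. w \<in> L}"
  by (auto simp: r_coset_def int_vec_group_def add.commute)

theorem theorem1p4:
  fixes v :: "nat \<Rightarrow> int ^ 'd::finite"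
    and L :: "nat \<Rightarrow> (int ^ 'd) set"
    and n p k i :: nat
  assumes "lattice_tiling n v L"
    and "prime p"
    and "k \<ge> 1"
    and "i \<in> {1..n}"
    and "p ^ k dvd lattice_det (L i)"
  shows "\<exists>j\<in>{1..n}. j \<noteq> i \<and> p ^ k dvd lattice_det (L j)"
proof -
  have carrier: "carrier int_vec_group = (UNIV :: (int ^ 'd) set)"
    by (simp add: int_vec_group_def)
  show ?thesis
    unfolding lattice_det_def
  proof (rule group.coset_partition_prime_power_dvd_second_index[OF group_int_vec_group,
        where v = v])
    show "disjoint_family_on (\<lambda>j. L j #>\<^bsub>int_vec_group\<^esub> v j) {1..n}"
      using assms(1) by (simp add: lattice_tiling_def r_coset_int_vec_group)
    show "(\<Union>j\<in>{1..n}. L j #>\<^bsub>int_vec_group\<^esub> v j) = carrier int_vec_group"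
      using assms(1) by (simp add: lattice_tiling_def r_coset_int_vec_group carrier)
  qed (use assms carrier in \<open>auto simp: lattice_tiling_def sublattice_def lattice_det_def\<close>)
qed

end
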